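(* Let $D$ be a dendrite and let $f\colon D\to D$ be a (continuous) monotone map. Then $f$ has the shadowing property if and only if the induced map $C(f)\colon\mathcal{C}(D)\to\mathcal{C}(D)$ has the shadowing property.
   Context: A continuum is a non-empty compact connected metric space; a Peano continuum is a locally connected continuum. A dendrite is a Peano continuum which does not contain a simple closed curve. A continuous map $f\colon X\to X$ is monotone if $f^{-1}(p)$ is connected for all $p\in X$. For a compact metric space $(X,d)$, $\mathcal{C}(X)$ is the set of all subcontinua of $X$ (non-empty compact connected subsets, singletons included) with the Hausdorff distance $d_H$; for continuous $f\colon X\to X$, $C(f)(A)=f(A)$. A continuous map $g\colon Y\to Y$ of a compact metric space $(Y,\rho)$ (not necessarily invertible) has the shadowing property if for every $\varepsilon>0$ there is $\delta>0$ such that for each sequence $(x_n)_{n\in\mathbb{N}}$ (indexed by $n=0,1,2,\dots$) in $Y$ with $\rho(g(x_n),x_{n+1})<\delta$ for all $n$ there is $y\in Y$ with $\rho(g^n(y),x_n)<\varepsilon$ for all $n$. (For homeomorphisms one may equivalently use sequences indexed by $\mathbb{Z}$.) *)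

theory Defs
  imports "HOL-Analysis.Analysis"
begin

text \<open>A compact metric space is represented by a compact set in a type of class
  \<^class>\<open>metric_space\<close>, with the metric \<^const>\<open>dist\<close> restricted to it.
  A self-map of it is a function mapping the set into itself; its values elsewhere are irrelevant.\<close>

definition continuum :: "'a::metric_space set \<Rightarrow> bool" where
  "continuum X \<longleftrightarrow> X \<noteq> {} \<and> compact X \<and> connected X"

definition peano_continuum :: "'a::metric_space set \<Rightarrow> bool" where
  "peano_continuum X \<longleftrightarrow> continuum X \<and> locally connected X"

definition simple_closed_curve :: "'a::metric_space set \<Rightarrow> bool" where
  "simple_closed_curve C \<longleftrightarrow> C homeomorphic (sphere 0 1 :: complex set)"

text \<open>One-point spaces count as dendrites.\<close>

definition dendrite :: "'a::metric_space set \<Rightarrow> bool" where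
  "dendrite X \<longleftrightarrow> peano_continuum X \<and> \<not> (\<exists>C\<subseteq>X. simple_closed_curve C)"

definition subcontinua :: "'a::metric_space set \<Rightarrow> 'a set set" where
  "subcontinua X = {A. A \<subseteq> X \<and> continuum A}"

text \<open>Meaningful for non-empty bounded sets only, in particular for subcontinua: on the reals
  \<^const>\<open>Sup\<close> of an unbounded set is unspecified, and \<^term>\<open>infdist a {}\<close> is 0.\<close>

definition hausdorff_dist :: "'a::metric_space set \<Rightarrow> 'a set \<Rightarrow> real" where
  "hausdorff_dist A B = max (SUP a\<in>A. infdist a B) (SUP b\<in>B. infdist b A)"

definition induced_map :: "('a \<Rightarrow> 'b) \<Rightarrow> 'a set \<Rightarrow> 'b set" where
  "induced_map f A = f ` A"

text \<open>The metric \<open>\<rho>\<close> is a parameter, so that the definition applies both to a subset of a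
  metric space type and to a space of sets under \<^const>\<open>hausdorff_dist\<close>.\<close>

definition shadowing_property :: "'a set \<Rightarrow> ('a \<Rightarrow> 'a \<Rightarrow> real) \<Rightarrow> ('a \<Rightarrow> 'a) \<Rightarrow> bool" where
  "shadowing_property Y \<rho> g \<longleftrightarrow>
    (\<forall>\<epsilon>>0. \<exists>\<delta>>0. \<forall>x :: nat \<Rightarrow> 'a.
      (\<forall>n. x n \<in> Y) \<and> (\<forall>n. \<rho> (g (x n)) (x (Suc n)) < \<delta>) \<longrightarrow>
      (\<exists>y\<in>Y. \<forall>n. \<rho> ((g ^^ n) y) (x n) < \<epsilon>))"

end

theory Submission
  imports Defs
begin

text \<open>One direction is easy and holds for every bounded invariant set: points can be regarded as singletons. For the
  other direction, let \<open>f\<close> have the shadowing property and let \<open>A\<close> be a pseudo-orbit of subcontinua of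
  the dendrite. The natural candidate for a shadowing continuum is the set \<open>Y\<close> of all points whose
  orbit stays close to the sets \<open>A n\<close>. It is large enough: through each point of each \<open>A n\<close> there is a
  pseudo-orbit of points that stays in \<open>A\<close>, and a point that shadows it belongs to \<open>Y\<close>. The
  difficulty is that \<open>Y\<close> has to be connected.

  Closeness to \<open>A n\<close> is therefore expressed by membership in a subcontinuum \<open>K n\<close> that is slightly
  larger than \<open>A n\<close> and contains a neighbourhood of it; it exists because a Peano continuum is
  uniformly locally connected (\<open>subcontinuum_enlargement\<close>). Then \<open>Y\<close> is the intersection of the
  preimages of the \<open>K n\<close> under the iterates of \<open>f\<close>. In a dendrite any two subcontinua have a
  connected intersection (\<open>dendrite_imp_hereditarily_unicoherent\<close>). Hence the preimage of a
  subcontinuum under a monotone map is connected (\<open>subcontinuum_monotone_preimage\<close>), and so is a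
  countable intersection of subcontinua (\<open>connected_INT_hereditarily_unicoherent\<close>).

  Hereditary unicoherence is derived from the absence of simple closed curves. If the intersection
  of two subcontinua falls into two separated pieces, then two points from different pieces are
  joined by an arc near the first continuum and by an arc near the second
  (\<open>connected_imp_path_near\<close>), and these arcs contain a simple closed curve
  (\<open>simple_closed_curve_of_two_arcs\<close>). The arcs are constructed in a Banach space, into which every
  metric space embeds isometrically.\<close>

section \<open>Uniform local connectedness\<close>

definition uniformly_locally_connected :: "'a::metric_space set \<Rightarrow> bool" where
  "uniformly_locally_connected X \<longleftrightarrow> (\<forall>\<epsilon>>0. \<exists>\<delta>>0. \<forall>x\<in>X. \<forall>y\<in>X. dist x y < \<delta> \<longrightarrow>
     (\<exists>C. connected C \<and> C \<subseteq> X \<and> x \<in> C \<and> y \<in> C \<and> C \<subseteq> ball x \<epsilon>))"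

text \<open>Open sets that meet \<open>X\<close> in a connected set of small diameter cover \<open>X\<close>; a Lebesgue
  number of this cover is the required \<open>\<delta>\<close>.\<close>

lemma compact_locally_connected_imp_uniformly:
  fixes X :: "'a::metric_space set"
  assumes "compact X" "locally connected X"
  shows "uniformly_locally_connected X"
  unfolding uniformly_locally_connected_def
proof (intro allI impI)
  fix \<epsilon> :: real assume "\<epsilon> > 0"
  define \<G> where "\<G> = {G. open G \<and> connected (X \<inter> G) \<and> (\<forall>u\<in>X \<inter> G. \<forall>v\<in>X \<inter> G. dist u v < \<epsilon>)}"
  have "X \<subseteq> \<Union>\<G>"
  proof
    fix x assume "x \<in> X"
    have "openin (top_of_set X) (X \<inter> ball x (\<epsilon>/2))" "x \<in> X \<inter> ball x (\<epsilon>/2)"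
      using \<open>x \<in> X\<close> \<open>\<epsilon> > 0\<close> by (auto simp: openin_open)
    then obtain u where u: "openin (top_of_set X) u" "connected u" "x \<in> u" "u \<subseteq> X \<inter> ball x (\<epsilon>/2)"
      using assms(2) unfolding locally_connected by meson
    then obtain G where G: "open G" "u = X \<inter> G"
      by (auto simp: openin_open)
    have "dist a b < \<epsilon>" if "a \<in> u" "b \<in> u" for a b
    proof -
      have "dist x a < \<epsilon>/2" "dist x b < \<epsilon>/2" using u(4) that by auto
      then show ?thesis using dist_triangle_half_r by blast
    qed
    then have "G \<in> \<G>" using G u by (auto simp: \<G>_def)
    then show "x \<in> \<Union>\<G>" using u G by auto
  qed
  then obtain \<delta> where d: "\<delta> > 0" "\<And>x. x \<in> X \<Longrightarrow> \<exists>G\<in>\<G>. ball x \<delta> \<subseteq> G"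
    using Heine_Borel_lemma[OF assms(1), of \<G>] unfolding \<G>_def by blast
  have "\<exists>C. connected C \<and> C \<subseteq> X \<and> x \<in> C \<and> y \<in> C \<and> C \<subseteq> ball x \<epsilon>"
    if "x \<in> X" "y \<in> X" "dist x y < \<delta>" for x y
  proof -
    obtain G where G: "G \<in> \<G>" "ball x \<delta> \<subseteq> G" using d(2) \<open>x \<in> X\<close> by blast
    then have "x \<in> G" "y \<in> G" using that d(1) by auto
    then show ?thesis
      using G that by (intro exI[of _ "X \<inter> G"]) (auto simp: \<G>_def)
  qed
  then show "\<exists>\<delta>>0. \<forall>x\<in>X. \<forall>y\<in>X. dist x y < \<delta> \<longrightarrow>
     (\<exists>C. connected C \<and> C \<subseteq> X \<and> x \<in> C \<and> y \<in> C \<and> C \<subseteq> ball x \<epsilon>)"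
    using d(1) by blast
qed

section \<open>Paths near connected sets\<close>

text \<open>The broken lines through finitely many points of \<open>C\<close> with consecutive distances below
  \<open>\<delta>\<close>; only the vertices need to lie in \<open>C\<close>. Building them with \<^const>\<open>joinpaths\<close> rather than
  from a list of vertices lets a refinement be carried out segment by segment, because a path close
  to \<open>g\<close> joined to a path close to \<open>h\<close> is close to \<open>g +++ h\<close> in the same parametrization.\<close>

inductive polygonal :: "'a::real_normed_vector set \<Rightarrow> real \<Rightarrow> (real \<Rightarrow> 'a) \<Rightarrow> bool"
  for C \<delta> where
  segment: "x \<in> C \<Longrightarrow> y \<in> C \<Longrightarrow> dist x y < \<delta> \<Longrightarrow> polygonal C \<delta> (linepath x y)"
| join: "polygonal C \<delta> g \<Longrightarrow> polygonal C \<delta> h \<Longrightarrow> pathfinish g = pathstart h \<Longrightarrow> polygonal C \<delta> (g +++ h)"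

lemma polygonal_imp_path: "polygonal C \<delta> g \<Longrightarrow> path g"
  by (induction rule: polygonal.induct) auto

lemma polygonal_mono:
  assumes "polygonal C \<delta> g" "C \<subseteq> D"
  shows "polygonal D \<delta> g"
  using assms(1)
  by (induction rule: polygonal.induct) (use assms(2) in \<open>auto intro: polygonal.intros\<close>)

lemma dist_linepath_le:
  assumes "t \<in> {0..1}"
  shows "dist x (linepath x y t) \<le> dist x y"
proof -
  have "x - linepath x y t = t *\<^sub>R (x - y)"
    by (simp add: linepath_def algebra_simps)
  then show ?thesis
    using assms by (simp add: dist_norm mult_left_le_one_le)
qed

lemma polygonal_near:
  assumes "polygonal C \<delta> g" "t \<in> {0..1}"
  shows "\<exists>c\<in>C. dist c (g t) < \<delta>"
  using assms
proof (induction arbitrary: t rule: polygonal.induct)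
  case (segment x y)
  then show ?case
    using dist_linepath_le[of t x y] by (intro bexI[of _ x]) auto
next
  case (join g h)
  then show ?case
    unfolding joinpaths_def by (cases "t \<le> 1/2") auto
qed

text \<open>The set of points of \<open>C\<close> that can be reached from \<open>x\<close> by a chain with steps below \<open>\<delta>\<close> is
  both open and closed in \<open>C\<close>.\<close>

lemma connected_imp_polygonal:
  assumes "connected C" "x \<in> C" "y \<in> C" "\<delta> > 0"
  obtains g where "polygonal C \<delta> g" "pathstart g = x" "pathfinish g = y"
proof -
  define P where "P z \<longleftrightarrow> (\<exists>g. polygonal C \<delta> g \<and> pathstart g = x \<and> pathfinish g = z)" for z
  have step: "P v" if "P u" "u \<in> C" "v \<in> C" "dist u v < \<delta>" for u v
  proof -
    obtain g where g: "polygonal C \<delta> g" "pathstart g = x" "pathfinish g = u"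
      using \<open>P u\<close> P_def by blast
    have "polygonal C \<delta> (g +++ linepath u v)"
      using g that by (intro polygonal.intros) auto
    then show ?thesis
      unfolding P_def using g by (intro exI[of _ "g +++ linepath u v"]) auto
  qed
  have "P y"
  proof (rule connected_induction_simple[OF assms(1), of x])
    show "P x"
      unfolding P_def using assms
      by (intro exI[of _ "linepath x x"]) (auto intro: polygonal.intros)
    fix a assume "a \<in> C"
    show "\<exists>T. openin (top_of_set C) T \<and> a \<in> T \<and> (\<forall>x\<in>T. \<forall>y\<in>T. P x \<longrightarrow> P y)"
    proof (intro exI[of _ "C \<inter> ball a (\<delta>/2)"] conjI ballI impI)
      show "openin (top_of_set C) (C \<inter> ball a (\<delta>/2))" by (auto simp: openin_open)
      show "a \<in> C \<inter> ball a (\<delta>/2)" using \<open>a \<in> C\<close> assms by auto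
      fix u v assume uv: "u \<in> C \<inter> ball a (\<delta>/2)" "v \<in> C \<inter> ball a (\<delta>/2)" "P u"
      then have "dist a u < \<delta>/2" "dist a v < \<delta>/2" by auto
      then have "dist u v < \<delta>" using dist_triangle_half_r by blast
      then show "P v" using uv step by blast
    qed
  qed (use assms in auto)
  then show ?thesis using that P_def by blast
qed

text \<open>Every segment joins two points of a connected subset of \<open>X\<close> of size \<open>\<epsilon>\<close>, and is replaced by
  a finer broken line with vertices in that subset, which therefore stays nearby.\<close>

lemma polygonal_refine:
  assumes ulc: "\<And>x y. x \<in> X \<Longrightarrow> y \<in> X \<Longrightarrow> dist x y < \<delta> \<Longrightarrow>
      \<exists>C. connected C \<and> C \<subseteq> X \<and> x \<in> C \<and> y \<in> C \<and> C \<subseteq> ball x \<epsilon>"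
    and "\<delta>' > 0" "polygonal X \<delta> g"
  obtains h where "polygonal X \<delta>' h" "pathstart h = pathstart g" "pathfinish h = pathfinish g"
    "\<And>t. t \<in> {0..1} \<Longrightarrow> dist (g t) (h t) < \<epsilon> + \<delta> + \<delta>'"
proof -
  have "\<exists>h. polygonal X \<delta>' h \<and> pathstart h = pathstart g \<and> pathfinish h = pathfinish g \<and>
        (\<forall>t\<in>{0..1}. dist (g t) (h t) < \<epsilon> + \<delta> + \<delta>')"
    using assms(3)
  proof (induction rule: polygonal.induct)
    case (segment x y)
    obtain C where C: "connected C" "C \<subseteq> X" "x \<in> C" "y \<in> C" "C \<subseteq> ball x \<epsilon>"
      using ulc segment by blast
    obtain h where h: "polygonal C \<delta>' h" "pathstart h = x" "pathfinish h = y"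
      using connected_imp_polygonal[OF C(1,3,4) \<open>\<delta>' > 0\<close>] by blast
    have "dist (linepath x y t) (h t) < \<epsilon> + \<delta> + \<delta>'" if t: "t \<in> {0..1}" for t
    proof -
      obtain c where c: "c \<in> C" "dist c (h t) < \<delta>'"
        using polygonal_near[OF h(1) t] by blast
      then have "dist x c < \<epsilon>" using C by auto
      moreover have "dist x (linepath x y t) < \<delta>"
        using dist_linepath_le[OF t, of x y] segment by linarith
      moreover have "dist (linepath x y t) (h t) \<le> dist x (linepath x y t) + dist x c + dist c (h t)"
        by (metis add.assoc add_left_mono dist_commute dist_triangle dual_order.trans)
      ultimately show ?thesis using c by linarith
    qed
    then show ?case
      using h C polygonal_mono by (intro exI[of _ h]) auto
  next
    case (join g1 g2)
    then obtain h1 h2 where h: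
      "polygonal X \<delta>' h1" "pathstart h1 = pathstart g1" "pathfinish h1 = pathfinish g1"
      "\<And>t. t\<in>{0..1} \<Longrightarrow> dist (g1 t) (h1 t) < \<epsilon> + \<delta> + \<delta>'"
      "polygonal X \<delta>' h2" "pathstart h2 = pathstart g2" "pathfinish h2 = pathfinish g2"
      "\<And>t. t\<in>{0..1} \<Longrightarrow> dist (g2 t) (h2 t) < \<epsilon> + \<delta> + \<delta>'"
      by metis
    have "dist ((g1 +++ g2) t) ((h1 +++ h2) t) < \<epsilon> + \<delta> + \<delta>'" if "t \<in> {0..1}" for t
      using that h(4)[of "2*t"] h(8)[of "2*t-1"] by (auto simp: joinpaths_def)
    then show ?case
      using h join by (intro exI[of _ "h1 +++ h2"]) (auto intro: polygonal.join)
  qed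
  then show ?thesis using that by blast
qed

text \<open>The path is the uniform limit of broken lines with ever shorter segments. Its values lie in
  \<open>X\<close> because the vertices become dense along the broken lines and \<open>X\<close> is closed. The ambient
  normed space makes every approximation continuous, and its completeness provides the limit.\<close>

lemma connected_imp_path_near:
  fixes X :: "'a::{real_normed_vector,complete_space} set"
  assumes "compact X" "uniformly_locally_connected X"
    and C: "connected C" "C \<subseteq> X" "x \<in> C" "y \<in> C" and "\<eta> > 0"
  obtains g where "path g" "pathstart g = x" "pathfinish g = y" "path_image g \<subseteq> X"
    "\<And>z. z \<in> path_image g \<Longrightarrow> \<exists>c\<in>C. dist c z < \<eta>"
proof -
  \<comment> \<open>Refinement step \<open>k\<close> moves a point by at most \<open>3 * \<epsilon> k\<close>, in total by at most
    \<open>6 * \<epsilon> 0\<close>; the first broken line is within \<open>\<epsilon> 0\<close> of \<open>C\<close>, and \<open>7 * \<epsilon> 0 < \<eta>\<close>.\<close>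
  define \<epsilon> where "\<epsilon> k = \<eta>/16 * (1/2)^k" for k :: nat
  have \<epsilon>_pos: "\<epsilon> k > 0" for k using \<open>\<eta> > 0\<close> by (simp add: \<epsilon>_def)
  have "\<exists>\<delta>>0. \<delta> \<le> \<epsilon> k \<and> (\<forall>x\<in>X. \<forall>y\<in>X. dist x y < \<delta> \<longrightarrow>
     (\<exists>C. connected C \<and> C \<subseteq> X \<and> x \<in> C \<and> y \<in> C \<and> C \<subseteq> ball x (\<epsilon> k)))" for k
  proof -
    obtain \<delta> where "\<delta> > 0" and *: "\<forall>x\<in>X. \<forall>y\<in>X. dist x y < \<delta> \<longrightarrow>
     (\<exists>C. connected C \<and> C \<subseteq> X \<and> x \<in> C \<and> y \<in> C \<and> C \<subseteq> ball x (\<epsilon> k))"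
      using assms(2) \<epsilon>_pos unfolding uniformly_locally_connected_def by meson
    then show ?thesis
      using \<epsilon>_pos by (intro exI[of _ "min \<delta> (\<epsilon> k)"]) auto
  qed
  then obtain \<delta> where d: "\<And>k. \<delta> k > 0" "\<And>k. \<delta> k \<le> \<epsilon> k"
    "\<And>k x y. x\<in>X \<Longrightarrow> y\<in>X \<Longrightarrow> dist x y < \<delta> k \<Longrightarrow>
     (\<exists>C. connected C \<and> C \<subseteq> X \<and> x \<in> C \<and> y \<in> C \<and> C \<subseteq> ball x (\<epsilon> k))"
    using choice[of "\<lambda>k d. d > 0 \<and> d \<le> \<epsilon> k \<and> (\<forall>x\<in>X. \<forall>y\<in>X. dist x y < d \<longrightarrow>
     (\<exists>C. connected C \<and> C \<subseteq> X \<and> x \<in> C \<and> y \<in> C \<and> C \<subseteq> ball x (\<epsilon> k)))"] by blast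
  obtain h0 where h0: "polygonal C (\<delta> 0) h0" "pathstart h0 = x" "pathfinish h0 = y"
    using connected_imp_polygonal[OF C(1,3,4) d(1)[of 0]] by blast
  define Q where "Q k h \<longleftrightarrow> polygonal X (\<delta> k) h \<and> pathstart h = x \<and> pathfinish h = y \<and>
    (k = 0 \<longrightarrow> h = h0)" for k h
  have "\<exists>h. \<forall>k. Q k (h k) \<and> (\<forall>t\<in>{0..1}. dist (h k t) (h (Suc k) t) \<le> 3 * \<epsilon> k)"
  proof (rule dependent_nat_choice)
    show "\<exists>h. Q 0 h" unfolding Q_def using h0 polygonal_mono C by blast
    fix g k assume g: "Q k g"
    obtain h where h: "polygonal X (\<delta> (Suc k)) h" "pathstart h = pathstart g" "pathfinish h = pathfinish g"
      "\<And>t. t \<in> {0..1} \<Longrightarrow> dist (g t) (h t) < \<epsilon> k + \<delta> k + \<delta> (Suc k)"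
    proof (rule polygonal_refine[of X "\<delta> k" "\<epsilon> k" "\<delta> (Suc k)" g])
      show "polygonal X (\<delta> k) g" using g Q_def by blast
    qed (use d in blast)+
    have "\<epsilon> (Suc k) \<le> \<epsilon> k" using \<open>\<eta> > 0\<close> by (simp add: \<epsilon>_def)
    then have "\<epsilon> k + \<delta> k + \<delta> (Suc k) \<le> 3 * \<epsilon> k"
      using d(2)[of k] d(2)[of "Suc k"] by linarith
    then have "\<forall>t\<in>{0..1}. dist (g t) (h t) \<le> 3 * \<epsilon> k" using h(4) by force
    then show "\<exists>h. Q (Suc k) h \<and> (\<forall>t\<in>{0..1}. dist (g t) (h t) \<le> 3 * \<epsilon> k)"
      using h g unfolding Q_def by (intro exI[of _ h]) auto
  qed
  then obtain h where hQ: "\<And>k. Q k (h k)"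
    and hs: "\<And>k t. t \<in> {0..1} \<Longrightarrow> dist (h k t) (h (Suc k) t) \<le> 3 * \<epsilon> k"
    by blast
  have tele: "dist (h m t) (h (m + j) t) \<le> 6 * \<epsilon> m - 6 * \<epsilon> (m + j)" if "t \<in> {0..1}" for m j t
  proof (induction j)
    case (Suc j)
    have "6 * \<epsilon> (m + j) - 6 * \<epsilon> (m + Suc j) = 3 * \<epsilon> (m + j)"
      by (simp add: \<epsilon>_def)
    then show ?case
      using Suc hs[OF that, of "m+j"] dist_triangle[of "h m t" "h (m + Suc j) t" "h (m+j) t"]
      by simp
  qed simp
  have close: "dist (h m t) (h n t) \<le> 6 * \<epsilon> m" if "t \<in> {0..1}" "m \<le> n" for m n t
    using tele[OF that(1), of m "n - m"] \<epsilon>_pos[of n] that(2) by simp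
  have \<epsilon>0: "\<epsilon> \<longlonglongrightarrow> 0"
  proof -
    have "(\<lambda>k. \<eta>/16 * (1/2)^k) \<longlonglongrightarrow> \<eta>/16 * 0"
      by (intro tendsto_mult tendsto_const LIMSEQ_power_zero) auto
    then show ?thesis by (simp add: \<epsilon>_def[abs_def])
  qed
  have small: "\<exists>m. \<forall>n\<ge>m. \<epsilon> n < e" if "e > 0" for e
    using order_tendstoD(2)[OF \<epsilon>0 that] by (auto simp: eventually_sequentially)
  have "uniformly_Cauchy_on {0..1} h"
  proof (rule uniformly_Cauchy_onI')
    fix e :: real assume "e > 0"
    then obtain M where M: "\<forall>n\<ge>M. \<epsilon> n < e/6" using small[of "e/6"] by auto
    show "\<exists>M. \<forall>t\<in>{0..1}. \<forall>m\<ge>M. \<forall>n>m. dist (h m t) (h n t) < e"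
    proof (intro exI[of _ M] ballI allI impI)
      fix t m n assume "t \<in> {0..1::real}" "m \<ge> M" "n > m"
      then show "dist (h m t) (h n t) < e" using close[of t m n] M by fastforce
    qed
  qed
  then obtain l where l: "uniform_limit {0..1} h l sequentially"
    using uniformly_convergent_eq_Cauchy uniformly_convergent_on_def by blast
  have lim: "(\<lambda>n. h n t) \<longlonglongrightarrow> l t" if "t \<in> {0..1}" for t
    using tendsto_uniform_limitI[OF l that] .
  have "path (h k)" for k
    using hQ polygonal_imp_path Q_def by blast
  then have pl: "path l"
    unfolding path_def by (intro uniform_limit_theorem[OF _ l]) auto
  have "pathstart l = x"
  proof -
    have "(\<lambda>n. h n 0) \<longlonglongrightarrow> x" using hQ by (simp add: Q_def pathstart_def)
    then show ?thesis using lim[of 0] LIMSEQ_unique unfolding pathstart_def by fastforce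
  qed
  moreover have "pathfinish l = y"
  proof -
    have "(\<lambda>n. h n 1) \<longlonglongrightarrow> y" using hQ by (simp add: Q_def pathfinish_def)
    then show ?thesis using lim[of 1] LIMSEQ_unique unfolding pathfinish_def by fastforce
  qed
  moreover have "l t \<in> X" if t: "t \<in> {0..1}" for t
  proof -
    have "\<exists>p. \<forall>n. p n \<in> X \<and> dist (p n) (h n t) < \<epsilon> n"
    proof (rule choice, rule allI)
      fix n
      have "polygonal X (\<delta> n) (h n)" using hQ Q_def by blast
      then show "\<exists>p. p \<in> X \<and> dist p (h n t) < \<epsilon> n"
        using polygonal_near[OF _ t] d(2)[of n] by force
    qed
    then obtain p where p: "\<And>n. p n \<in> X" "\<And>n. dist (p n) (h n t) < \<epsilon> n" by blast
    have "(\<lambda>n. dist (h n t) (p n)) \<longlonglongrightarrow> 0"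
      by (rule tendsto_sandwich[OF _ _ tendsto_const \<epsilon>0])
         (use p in \<open>auto simp: less_imp_le dist_commute\<close>)
    then have "(\<lambda>n. h n t - p n) \<longlonglongrightarrow> 0"
      by (simp add: dist_norm tendsto_norm_zero_iff)
    then have "(\<lambda>n. h n t - (h n t - p n)) \<longlonglongrightarrow> l t - 0"
      by (intro tendsto_diff lim[OF t])
    then have "p \<longlonglongrightarrow> l t" by simp
    then show ?thesis
      using closed_sequentially[OF compact_imp_closed[OF assms(1)]] p(1) by blast
  qed
  moreover have "\<exists>c\<in>C. dist c (l t) < \<eta>" if t: "t \<in> {0..1}" for t
  proof -
    have "h 0 = h0" using hQ Q_def by blast
    then obtain c where c: "c \<in> C" "dist c (h 0 t) < \<delta> 0"
      using polygonal_near[OF h0(1) t] by auto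
    have "(\<lambda>n. dist (h 0 t) (h n t)) \<longlonglongrightarrow> dist (h 0 t) (l t)"
      by (intro tendsto_intros lim t)
    then have "dist (h 0 t) (l t) \<le> 6 * \<epsilon> 0"
      by (rule LIMSEQ_le_const2) (use close[OF t] in auto)
    then have "dist c (l t) < 7 * \<epsilon> 0"
      using c d(2)[of 0] dist_triangle[of c "l t" "h 0 t"] by linarith
    also have "\<dots> < \<eta>" using \<open>\<eta> > 0\<close> by (simp add: \<epsilon>_def)
    finally show ?thesis using c by blast
  qed
  ultimately show ?thesis
    by (intro that[of l] pl) (auto simp: path_image_def)
qed

section \<open>Dendrites are hereditarily unicoherent\<close>

definition hereditarily_unicoherent :: "'a::metric_space set \<Rightarrow> bool" where
  "hereditarily_unicoherent X \<longleftrightarrow>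
    (\<forall>A B. A \<subseteq> X \<and> B \<subseteq> X \<and> compact A \<and> compact B \<and> connected A \<and> connected B \<longrightarrow>
      connected (A \<inter> B))"

text \<open>The open sets \<open>U\<close> and \<open>V\<close> split the common points of the arcs into two compact classes.
  A subarc of \<open>\<alpha>\<close> that runs from one class to the other and is as short as possible in the parameter
  has no further common point inside, so together with the subarc of \<open>\<beta>\<close> between its endpoints it
  forms a simple closed curve.\<close>

lemma simple_closed_curve_of_two_arcs:
  fixes \<alpha> \<beta> :: "real \<Rightarrow> 'a::real_normed_vector"
  assumes "arc \<alpha>" "arc \<beta>"
    and cover: "path_image \<alpha> \<inter> path_image \<beta> \<subseteq> U \<union> V"
    and "open U" "open V" "U \<inter> V = {}"
    and "x \<in> path_image \<alpha> \<inter> path_image \<beta> \<inter> U" "y \<in> path_image \<alpha> \<inter> path_image \<beta> \<inter> V"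
  obtains C where "C \<subseteq> path_image \<alpha> \<union> path_image \<beta>" "simple_closed_curve C"
proof -
  have cont: "continuous_on {0..1} \<alpha>" and "inj_on \<alpha> {0..1}"
    using assms(1) by (auto simp: arc_def path_def)
  \<comment> \<open>As \<open>U\<close> and \<open>V\<close> cover the common points, \<open>S V\<close> consists of the parameters of those in \<open>U\<close>,
    and \<open>S U\<close> of those in \<open>V\<close>. Removing an open set makes compactness visible.\<close>
  define S where "S W = {0..1} \<inter> \<alpha> -` (path_image \<beta> - W)" for W
  have comp: "compact (S W)" if "open W" for W
  proof -
    have "closed (path_image \<beta> - W)"
      by (intro closed_Diff closed_path_image arc_imp_path assms(2) that)
    then have "closed (S W)"
      unfolding S_def by (intro continuous_closed_preimage cont) auto
    then show ?thesis
      using compact_Int_closed[OF compact_Icc, of "S W" 0 1] by (simp add: S_def)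
  qed
  have "x \<in> \<alpha> ` S V" "y \<in> \<alpha> ` S U"
    using assms(6-8) by (auto simp: S_def path_image_def)
  then have ne: "S V \<times> S U \<noteq> {}" by auto
  have "compact (S V \<times> S U)" using comp assms by (intro compact_Times) auto
  moreover have "continuous_on (S V \<times> S U) (\<lambda>p. dist (fst p) (snd p))"
    by (intro continuous_intros)
  ultimately obtain p where p: "p \<in> S V \<times> S U"
    "\<And>q. q \<in> S V \<times> S U \<Longrightarrow> dist (fst p) (snd p) \<le> dist (fst q) (snd q)"
    using continuous_attains_inf[OF _ ne] by blast
  define s where "s = fst p"
  define t where "t = snd p"
  have s: "s \<in> {0..1}" "\<alpha> s \<in> path_image \<beta>" "\<alpha> s \<notin> V"
    and t: "t \<in> {0..1}" "\<alpha> t \<in> path_image \<beta>" "\<alpha> t \<notin> U"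
    using p(1) by (auto simp: s_def t_def S_def)
  have inU: "\<alpha> s \<in> U" and inV: "\<alpha> t \<in> V"
    using s t cover unfolding path_image_def by blast+
  have "s \<noteq> t" using inU t by auto
  have between: "r = s \<or> r = t" if r: "r \<in> closed_segment s t" "\<alpha> r \<in> path_image \<beta>" for r
  proof -
    have r01: "r \<in> {0..1}"
      using r(1) s(1) t(1) by (auto simp: closed_segment_eq_real_ivl split: if_splits)
    then have "\<alpha> r \<in> U \<union> V" using cover r(2) unfolding path_image_def by blast
    then have "r \<in> S V \<or> r \<in> S U" using r01 r(2) assms(6) by (auto simp: S_def)
    then have "dist s t \<le> dist r t \<or> dist s t \<le> dist s r"
      using p unfolding s_def t_def by fastforce
    then show ?thesis
      using r(1) by (auto simp: closed_segment_eq_real_ivl dist_real_def split: if_splits)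
  qed
  obtain u v where u: "u \<in> {0..1}" "\<beta> u = \<alpha> s" and v: "v \<in> {0..1}" "\<beta> v = \<alpha> t"
    using s(2) t(2) by (auto simp: path_image_def)
  have "u \<noteq> v" using u v inU t by auto
  let ?a = "subpath s t \<alpha>" and ?b = "subpath v u \<beta>"
  have sub: "path_image ?a \<subseteq> path_image \<alpha>" "path_image ?b \<subseteq> path_image \<beta>"
    using s t u v path_image_subpath_subset by blast+
  have "simple_path (?a +++ ?b)"
  proof (rule simple_path_join_loop)
    show "arc ?a" "arc ?b"
      using arc_subpath_arc[OF assms(1) s(1) t(1)] arc_subpath_arc[OF assms(2) v(1) u(1)]
        \<open>s \<noteq> t\<close> \<open>u \<noteq> v\<close> by auto
    show "path_image ?a \<inter> path_image ?b \<subseteq> {pathstart ?a, pathstart ?b}"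
    proof
      fix z assume z: "z \<in> path_image ?a \<inter> path_image ?b"
      then obtain r where "r \<in> closed_segment s t" "z = \<alpha> r"
        by (auto simp: path_image_subpath_gen)
      then show "z \<in> {pathstart ?a, pathstart ?b}"
        using between[of r] z sub v by auto
    qed
  qed (use u v in auto)
  moreover have "pathfinish (?a +++ ?b) = pathstart (?a +++ ?b)" using u by simp
  ultimately have "simple_closed_curve (path_image (?a +++ ?b))"
    unfolding simple_closed_curve_def by (intro homeomorphic_simple_path_image_circle) auto
  moreover have "path_image (?a +++ ?b) \<subseteq> path_image \<alpha> \<union> path_image \<beta>"
    using sub path_image_join_subset by blast
  ultimately show ?thesis using that by blast
qed

text \<open>If \<open>A \<inter> B\<close> is the union of two separated pieces, choose a point in each of them and join the two
  points by an arc near \<open>A\<close> and by an arc near \<open>B\<close>. A point close to both \<open>A\<close> and \<open>B\<close> is close to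
  \<open>A \<inter> B\<close>, so the arcs meet only near the two pieces and they contain a simple closed curve.
  Arcs in \<open>A\<close> and \<open>B\<close> themselves need not exist, because subcontinua of \<open>X\<close> are not known to be
  locally connected.\<close>

lemma no_simple_closed_curve_imp_hereditarily_unicoherent:
  fixes X :: "'a::{real_normed_vector,complete_space} set"
  assumes "compact X" "locally connected X"
    and no_circle: "\<And>C. C \<subseteq> X \<Longrightarrow> \<not> simple_closed_curve C"
  shows "hereditarily_unicoherent X"
  unfolding hereditarily_unicoherent_def
proof (intro allI impI, elim conjE)
  fix A B :: "'a set"
  assume AB: "A \<subseteq> X" "B \<subseteq> X" "compact A" "compact B" "connected A" "connected B"
  note ulc = compact_locally_connected_imp_uniformly[OF assms(1,2)]
  show "connected (A \<inter> B)"
  proof (rule ccontr)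
    assume "\<not> connected (A \<inter> B)"
    moreover have "closed (A \<inter> B)" using AB by (auto intro: compact_imp_closed)
    ultimately obtain P Q where PQ: "closed P" "closed Q" "P \<noteq> {}" "Q \<noteq> {}" "P \<union> Q = A \<inter> B" "P \<inter> Q = {}"
      unfolding connected_closed_set[OF \<open>closed (A \<inter> B)\<close>] by blast
    obtain U V where UV: "open U" "open V" "P \<subseteq> U" "Q \<subseteq> V" "U \<inter> V = {}"
      using t4_space[OF PQ(1,2,6)] by blast
    obtain p q where pq: "p \<in> P" "q \<in> Q" using PQ by blast
    obtain \<eta> where \<eta>: "\<eta> > 0" "\<And>a b z. a \<in> A \<Longrightarrow> b \<in> B \<Longrightarrow> dist a z < \<eta> \<Longrightarrow> dist b z < \<eta> \<Longrightarrow> z \<in> X \<Longrightarrow> z \<in> U \<union> V"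
    proof -
      \<comment> \<open>On this compact set the larger of the distances to \<open>A\<close> and \<open>B\<close> is positive, hence it has
        a positive minimum.\<close>
      define K where "K = X - (U \<union> V)"
      have K: "compact K" unfolding K_def using assms(1) UV by (intro compact_diff) auto
      have ne: "A \<noteq> {}" "B \<noteq> {}" using pq PQ(5) by auto
      let ?g = "\<lambda>z. max (infdist z A) (infdist z B)"
      have pos: "?g z > 0" if "z \<in> K" for z
      proof (rule ccontr)
        assume "\<not> ?g z > 0"
        then have "infdist z A = 0" "infdist z B = 0"
          using infdist_nonneg[of z A] infdist_nonneg[of z B] by auto
        then have "z \<in> A" "z \<in> B"
          using in_closed_iff_infdist_zero[OF compact_imp_closed[OF AB(3)] ne(1)]
            in_closed_iff_infdist_zero[OF compact_imp_closed[OF AB(4)] ne(2)] by auto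
        then show False using that PQ(5) UV(3,4) unfolding K_def by blast
      qed
      have "\<exists>e>0. \<forall>z\<in>K. e \<le> ?g z"
      proof (cases "K = {}")
        case False
        have "continuous_on K ?g" by (intro continuous_intros)
        then obtain w where "w \<in> K" "\<And>z. z \<in> K \<Longrightarrow> ?g w \<le> ?g z"
          using continuous_attains_inf[OF K False] by blast
        then show ?thesis using pos by (intro exI[of _ "?g w"]) auto
      qed (auto intro: exI[of _ 1])
      then obtain e where e: "e > 0" "\<And>z. z \<in> K \<Longrightarrow> e \<le> ?g z" by blast
      show ?thesis
      proof (rule that[OF e(1)])
        fix a b z assume *: "a \<in> A" "b \<in> B" "dist a z < e" "dist b z < e" "z \<in> X"
        then have "infdist z A < e" "infdist z B < e"
          using infdist_le[of a A z] infdist_le[of b B z] by (auto simp: dist_commute)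
        then show "z \<in> U \<union> V" using e(2)[of z] * unfolding K_def by force
      qed
    qed
    have "p \<noteq> q" using pq PQ by auto
    have pqA: "p \<in> A" "p \<in> B" "q \<in> A" "q \<in> B" using pq PQ by auto
    have *: "\<exists>\<alpha>. arc \<alpha> \<and> pathstart \<alpha> = p \<and> pathfinish \<alpha> = q \<and> path_image \<alpha> \<subseteq> X \<and>
        (\<forall>z\<in>path_image \<alpha>. \<exists>c\<in>C. dist c z < \<eta>)"
      if C: "connected C" "C \<subseteq> X" "p \<in> C" "q \<in> C" for C
    proof -
      obtain g where g: "path g" "pathstart g = p" "pathfinish g = q" "path_image g \<subseteq> X"
        "\<And>z. z \<in> path_image g \<Longrightarrow> \<exists>c\<in>C. dist c z < \<eta>"
        using connected_imp_path_near[OF assms(1) ulc C \<eta>(1)] by blast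
      obtain \<alpha> where "arc \<alpha>" "path_image \<alpha> \<subseteq> path_image g" "pathstart \<alpha> = p" "pathfinish \<alpha> = q"
        using path_contains_arc[OF g(1-3) \<open>p \<noteq> q\<close>] by blast
      then show ?thesis using g(4,5) by (intro exI[of _ \<alpha>]) auto
    qed
    obtain \<alpha> where \<alpha>: "arc \<alpha>" "pathstart \<alpha> = p" "pathfinish \<alpha> = q" "path_image \<alpha> \<subseteq> X"
      "\<And>z. z\<in>path_image \<alpha> \<Longrightarrow> \<exists>c\<in>A. dist c z < \<eta>"
      using *[OF AB(5,1) pqA(1,3)] by blast
    obtain \<beta> where \<beta>: "arc \<beta>" "pathstart \<beta> = p" "pathfinish \<beta> = q" "path_image \<beta> \<subseteq> X"
      "\<And>z. z\<in>path_image \<beta> \<Longrightarrow> \<exists>c\<in>B. dist c z < \<eta>"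
      using *[OF AB(6,2) pqA(2,4)] by blast
    have "path_image \<alpha> \<inter> path_image \<beta> \<subseteq> U \<union> V"
    proof
      fix z assume "z \<in> path_image \<alpha> \<inter> path_image \<beta>"
      then have z: "z \<in> path_image \<alpha>" "z \<in> path_image \<beta>" by auto
      obtain a where "a \<in> A" "dist a z < \<eta>" using \<alpha>(5)[OF z(1)] by blast
      moreover obtain b where "b \<in> B" "dist b z < \<eta>" using \<beta>(5)[OF z(2)] by blast
      ultimately show "z \<in> U \<union> V" using \<eta>(2) \<alpha>(4) z(1) by blast
    qed
    moreover have "p \<in> path_image \<alpha> \<inter> path_image \<beta> \<inter> U" "q \<in> path_image \<alpha> \<inter> path_image \<beta> \<inter> V"
      using pathstart_in_path_image[of \<alpha>] pathstart_in_path_image[of \<beta>]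
        pathfinish_in_path_image[of \<alpha>] pathfinish_in_path_image[of \<beta>] \<alpha>(2,3) \<beta>(2,3) pq UV by auto
    ultimately obtain C where "C \<subseteq> path_image \<alpha> \<union> path_image \<beta>" "simple_closed_curve C"
      using simple_closed_curve_of_two_arcs[OF \<alpha>(1) \<beta>(1) _ UV(1,2,5)] by blast
    then show False using no_circle \<alpha>(4) \<beta>(4) by blast
  qed
qed

text \<open>The Kuratowski embedding into a Banach space. Subtracting the distance to a base point keeps
  the functions bounded when the surrounding space is unbounded.\<close>

definition kuratowski :: "'a::metric_space \<Rightarrow> 'a \<Rightarrow> ('a \<Rightarrow>\<^sub>C real)" where
  "kuratowski p x = Bcontfun (\<lambda>y. dist x y - dist p y)"

lemma kuratowski_apply: "kuratowski p x y = dist x y - dist p y"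
proof -
  have "(\<lambda>y. dist x y - dist p y) \<in> bcontfun"
  proof (rule bcontfun_normI)
    show "continuous_on UNIV (\<lambda>y. dist x y - dist p y)" by (intro continuous_intros)
    show "norm (dist x y - dist p y) \<le> dist x p" for y
      using abs_dist_diff_le[of x y p] dist_commute[of y p] by simp
  qed
  then show ?thesis by (simp add: kuratowski_def Bcontfun_inverse)
qed

lemma dist_kuratowski: "dist (kuratowski p x) (kuratowski p y) = dist x y"
proof (rule antisym)
  show "dist (kuratowski p x) (kuratowski p y) \<le> dist x y"
  proof (rule dist_bound)
    fix z
    show "dist (kuratowski p x z) (kuratowski p y z) \<le> dist x y"
      using abs_dist_diff_le[of x z y] dist_commute[of z y] by (simp add: kuratowski_apply dist_real_def)
  qed
  show "dist x y \<le> dist (kuratowski p x) (kuratowski p y)"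
    using dist_bounded[of "kuratowski p x" y "kuratowski p y"]
    by (simp add: kuratowski_apply dist_real_def)
qed

lemma kuratowski_homeomorphism:
  "homeomorphism A (kuratowski p ` A) (kuratowski p) (inv (kuratowski p))"
proof -
  have inj: "inj (kuratowski p)"
    by (metis dist_eq_0_iff dist_kuratowski injI)
  have 1: "continuous_on A (kuratowski p)"
    unfolding continuous_on_iff dist_kuratowski by blast
  have 2: "continuous_on (kuratowski p ` A) (inv (kuratowski p))"
    unfolding continuous_on_iff by (auto simp: dist_kuratowski inv_f_f[OF inj])
  show ?thesis
    by (rule homeomorphismI[OF 1 2]) (auto simp: inv_f_f[OF inj])
qed

text \<open>Being a dendrite and being hereditarily unicoherent are invariant under homeomorphism, so the
  Kuratowski embedding reduces the claim to subsets of a Banach space, where broken lines exist.\<close>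

lemma dendrite_imp_hereditarily_unicoherent:
  assumes "dendrite X"
  shows "hereditarily_unicoherent X"
proof -
  fix p :: 'a
  let ?e = "kuratowski p"
  have X: "compact X" "locally connected X" "\<And>C. C \<subseteq> X \<Longrightarrow> \<not> simple_closed_curve C"
    using assms by (auto simp: dendrite_def peano_continuum_def continuum_def)
  have hom: "A homeomorphic ?e ` A" for A
    using kuratowski_homeomorphism homeomorphic_def by blast
  have inj: "inj ?e" by (metis dist_eq_0_iff dist_kuratowski injI)
  have conn: "connected (?e ` A) \<longleftrightarrow> connected A" for A
    using hom homeomorphic_connectedness by blast
  have "hereditarily_unicoherent (?e ` X)"
  proof (rule no_simple_closed_curve_imp_hereditarily_unicoherent)
    show "compact (?e ` X)" using hom X(1) homeomorphic_compactness by blast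
    have "locally connected X \<longleftrightarrow> locally connected (?e ` X)"
      by (rule homeomorphic_locally[OF hom]) (rule homeomorphic_connectedness)
    then show "locally connected (?e ` X)" using X(2) by simp
    show "\<not> simple_closed_curve C" if sub: "C \<subseteq> ?e ` X" for C
    proof
      assume C: "simple_closed_curve C"
      obtain C' where C': "C' \<subseteq> X" "C = ?e ` C'" using subset_imageE[OF sub] by blast
      then have "simple_closed_curve C'"
        using C homeomorphic_trans[OF hom[of C']] unfolding simple_closed_curve_def by simp
      then show False using X(3) C'(1) by simp
    qed
  qed
  then have X': "connected (A \<inter> B)"
    if "A \<subseteq> ?e ` X" "B \<subseteq> ?e ` X" "compact A" "compact B" "connected A" "connected B" for A B
    using that unfolding hereditarily_unicoherent_def by simp
  have comp: "compact (?e ` A) \<longleftrightarrow> compact A" for A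
    using hom homeomorphic_compactness by blast
  show ?thesis
    unfolding hereditarily_unicoherent_def
  proof (intro allI impI, elim conjE)
    fix A B :: "'a set"
    assume "A \<subseteq> X" "B \<subseteq> X" "compact A" "compact B" "connected A" "connected B"
    then have "connected (?e ` A \<inter> ?e ` B)"
      by (intro X') (auto simp: comp conn)
    then show "connected (A \<inter> B)"
      by (simp add: conn flip: image_Int[OF inj])
  qed
qed

section \<open>Subcontinua of hereditarily unicoherent continua\<close>

text \<open>The partial intersections are connected by hereditary unicoherence. If open sets \<open>U\<close> and \<open>V\<close>
  separated the whole intersection, then by compactness some partial intersection would already lie
  in \<open>U \<union> V\<close>.\<close>

lemma connected_INT_hereditarily_unicoherent:
  fixes L :: "nat \<Rightarrow> 'a::metric_space set"
  assumes hu: "hereditarily_unicoherent X"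
    and L: "\<And>n. L n \<subseteq> X" "\<And>n. compact (L n)" "\<And>n. connected (L n)"
  shows "connected (\<Inter>n. L n)"
proof (rule ccontr)
  define M where "M n = (\<Inter>i\<le>n. L i)" for n
  have M_Suc: "M (Suc n) = M n \<inter> L (Suc n)" for n
    by (auto simp: M_def le_Suc_eq)
  have M: "M n \<subseteq> X \<and> compact (M n) \<and> connected (M n)" for n
  proof (induction n)
    case 0
    then show ?case using L by (simp add: M_def)
  next
    case (Suc n)
    then show ?case
      using hu L[of "Suc n"] unfolding M_Suc hereditarily_unicoherent_def
      by (auto intro: compact_Int)
  qed
  have LM: "(\<Inter>n. L n) = (\<Inter>n. M n)" by (auto simp: M_def)
  have closedL: "closed (\<Inter>n. L n)" using L(2) by (auto intro: compact_imp_closed)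
  assume "\<not> connected (\<Inter>n. L n)"
  then obtain P Q where PQ: "closed P" "closed Q" "P \<noteq> {}" "Q \<noteq> {}" "P \<union> Q = (\<Inter>n. L n)" "P \<inter> Q = {}"
    unfolding connected_closed_set[OF closedL] by blast
  obtain U V where UV: "open U" "open V" "P \<subseteq> U" "Q \<subseteq> V" "U \<inter> V = {}"
    using t4_space[OF PQ(1,2,6)] by blast
  have "(\<Inter>n. L n) \<subseteq> U \<union> V" using PQ(5) UV(3,4) by blast
  then have empty: "(L 0 - (U \<union> V)) \<inter> (\<Inter>n. L n) = {}" by blast
  have "\<exists>I. finite I \<and> (L 0 - (U \<union> V)) \<inter> (\<Inter>i\<in>I. L i) = {}"
  proof (rule ccontr)
    assume *: "\<nexists>I. finite I \<and> (L 0 - (U \<union> V)) \<inter> (\<Inter>i\<in>I. L i) = {}"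
    have "(L 0 - (U \<union> V)) \<inter> (\<Inter>n. L n) \<noteq> {}"
    proof (rule compact_imp_fip_image)
      show "compact (L 0 - (U \<union> V))"
        by (intro compact_diff open_Un L(2) UV(1,2))
      show "closed (L i)" for i by (intro compact_imp_closed L(2))
      show "(L 0 - (U \<union> V)) \<inter> (\<Inter>i\<in>I. L i) \<noteq> {}" if "finite I" for I
        using * that by blast
    qed
    then show False using empty by contradiction
  qed
  then obtain I where I: "finite I" "(L 0 - (U \<union> V)) \<inter> (\<Inter>i\<in>I. L i) = {}" by blast
  obtain n where "I \<subseteq> {..n}" using I(1) finite_nat_iff_bounded_le by blast
  then have "M n \<subseteq> L 0 \<inter> (\<Inter>i\<in>I. L i)" by (auto simp: M_def)
  then have n: "M n \<subseteq> U \<union> V" using I(2) by blast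
  have "P \<subseteq> M n" "Q \<subseteq> M n" using PQ(5) LM by blast+
  then have "U \<inter> M n \<noteq> {}" "V \<inter> M n \<noteq> {}" using PQ(3,4) UV(3,4) by blast+
  then show False
    using connectedD[of "M n" U V] M n UV by blast
qed

text \<open>A map with connected fibres need not be onto, so the connected set to pull back is
  \<open>K \<inter> f ` X\<close>. This is where hereditary unicoherence enters.\<close>

lemma subcontinuum_monotone_preimage:
  fixes X :: "'a::metric_space set"
  assumes "compact X" "connected X" "hereditarily_unicoherent X"
    and f: "continuous_on X f" "f ` X \<subseteq> X" "\<And>y. y \<in> X \<Longrightarrow> connected {x \<in> X. f x = y}"
    and K: "K \<subseteq> X" "compact K" "connected K"
  shows "compact {x \<in> X. f x \<in> K} \<and> connected {x \<in> X. f x \<in> K}"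
proof
  have "{x \<in> X. f x \<in> K} = X \<inter> f -` K" by auto
  then have "closedin (top_of_set X) {x \<in> X. f x \<in> K}"
    using continuous_closedin_preimage[OF f(1) compact_imp_closed[OF K(2)]] by simp
  then show "compact {x \<in> X. f x \<in> K}"
    using closedin_compact[OF assms(1)] by simp
  have fX: "compact (f ` X)" "connected (f ` X)"
    by (intro compact_continuous_image connected_continuous_image assms(1,2) f(1))+
  then have "connected (K \<inter> f ` X)"
    using assms(3)[unfolded hereditarily_unicoherent_def, rule_format, of K "f ` X"] f(2) K by blast
  have "connected (X \<inter> f -` (K \<inter> f ` X))"
  proof (rule connected_closed_monotone_preimage[OF f(1) refl])
    fix C assume "closedin (top_of_set X) C"
    then have "compact C" "C \<subseteq> X"
      using closedin_compact[OF assms(1)] closedin_imp_subset by blast+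
    then have "closed (f ` C)" "f ` C \<subseteq> f ` X"
      by (auto intro!: compact_imp_closed compact_continuous_image intro: continuous_on_subset[OF f(1)])
    then show "closedin (top_of_set (f ` X)) (f ` C)"
      by (rule closed_subset[rotated])
  next
    fix y assume "y \<in> f ` X"
    then show "connected (X \<inter> f -` {y})"
    proof -
      have "X \<inter> f -` {y} = {x \<in> X. f x = y}" by auto
      then show ?thesis using f(3) f(2) \<open>y \<in> f ` X\<close> by (simp add: subset_iff)
    qed
  qed (use \<open>connected (K \<inter> f ` X)\<close> in auto)
  moreover have "X \<inter> f -` (K \<inter> f ` X) = {x \<in> X. f x \<in> K}" by auto
  ultimately show "connected {x \<in> X. f x \<in> K}" by simp
qed

lemma subcontinuum_monotone_preimage_funpow:
  fixes X :: "'a::metric_space set"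
  assumes X: "compact X" "connected X" "hereditarily_unicoherent X"
    and f: "continuous_on X f" "f ` X \<subseteq> X" "\<And>y. y \<in> X \<Longrightarrow> connected {x \<in> X. f x = y}"
    and K: "K \<subseteq> X" "compact K" "connected K"
  shows "compact {x \<in> X. (f ^^ n) x \<in> K} \<and> connected {x \<in> X. (f ^^ n) x \<in> K}"
proof (induction n)
  case 0
  have "{x \<in> X. x \<in> K} = K" using K(1) by auto
  then show ?case using K by simp
next
  case (Suc n)
  have eq: "{x \<in> X. (f ^^ Suc n) x \<in> K} = {x \<in> X. f x \<in> {x \<in> X. (f ^^ n) x \<in> K}}"
    using f(2) by (auto simp: funpow_swap1)
  show ?case
    unfolding eq
  proof (rule subcontinuum_monotone_preimage[OF X f])
    show "{x \<in> X. (f ^^ n) x \<in> K} \<subseteq> X" by blast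
  qed (use Suc in \<open>blast+\<close>)
qed

text \<open>The closure of the union of all small connected sets that meet \<open>A\<close>. The width \<open>\<delta>\<close> of the
  neighbourhood that it contains comes from uniform local connectedness and is the same for all \<open>A\<close>.\<close>

lemma subcontinuum_enlargement:
  fixes X :: "'a::metric_space set"
  assumes "compact X" "uniformly_locally_connected X" "\<epsilon> > 0"
  obtains \<delta> where "\<delta> > 0"
    "\<And>A. A \<subseteq> X \<Longrightarrow> A \<noteq> {} \<Longrightarrow> connected A \<Longrightarrow>
      \<exists>K. K \<subseteq> X \<and> compact K \<and> connected K \<and> (\<forall>z\<in>K. \<exists>a\<in>A. dist a z < \<epsilon>) \<and>
        (\<forall>z\<in>X. (\<exists>a\<in>A. dist a z < \<delta>) \<longrightarrow> z \<in> K)"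
proof -
  obtain \<delta> where \<delta>: "\<delta> > 0" "\<forall>x\<in>X. \<forall>y\<in>X. dist x y < \<delta> \<longrightarrow>
     (\<exists>C. connected C \<and> C \<subseteq> X \<and> x \<in> C \<and> y \<in> C \<and> C \<subseteq> ball x (\<epsilon>/2))"
    using assms(2)[unfolded uniformly_locally_connected_def, THEN spec, of "\<epsilon>/2"] \<open>\<epsilon> > 0\<close>
    by auto
  have "\<exists>K. K \<subseteq> X \<and> compact K \<and> connected K \<and> (\<forall>z\<in>K. \<exists>a\<in>A. dist a z < \<epsilon>) \<and>
        (\<forall>z\<in>X. (\<exists>a\<in>A. dist a z < \<delta>) \<longrightarrow> z \<in> K)"
    if A: "A \<subseteq> X" "A \<noteq> {}" "connected A" for A
  proof -
    define F where "F = {C. connected C \<and> C \<subseteq> X \<and> (\<exists>a\<in>A. a \<in> C \<and> C \<subseteq> ball a (\<epsilon>/2))}"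
    define W where "W = (\<Union>C\<in>F. A \<union> C)"
    \<comment> \<open>\<open>F\<close> contains the singletons of points of \<open>A\<close>, so \<open>W\<close> is the union of \<open>F\<close>; adding \<open>A\<close> to each
      member gives all of them common points.\<close>
    have "connected W" unfolding W_def
    proof (rule connected_Union)
      show "connected S" if "S \<in> (\<union>) A ` F" for S
        using that A by (auto simp: F_def intro!: connected_Un)
      show "\<Inter> ((\<union>) A ` F) \<noteq> {}" using A(2) by blast
    qed
    have near: "\<exists>a\<in>A. dist a z < \<epsilon>/2" if "z \<in> W" for z
    proof -
      obtain C where C: "C \<in> F" "z \<in> A \<or> z \<in> C"
        using \<open>z \<in> W\<close> unfolding W_def by blast
      then show ?thesis
      proof (cases "z \<in> A")
        case True
        then show ?thesis using \<open>\<epsilon> > 0\<close> by (intro bexI[of _ z]) auto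
      next
        case False
        then obtain a where "a \<in> A" "C \<subseteq> ball a (\<epsilon>/2)" "z \<in> C"
          using C unfolding F_def by blast
        then show ?thesis by (intro bexI[of _ a]) auto
      qed
    qed
    have "W \<subseteq> X" using A(1) by (auto simp: W_def F_def)
    then have clX: "closure W \<subseteq> X"
      by (intro closure_minimal compact_imp_closed[OF assms(1)])
    show ?thesis
    proof (intro exI[of _ "closure W"] conjI ballI impI)
      show "compact (closure W)"
        using compact_Int_closed[OF assms(1) closed_closure[of W]] clX by (simp add: Int_absorb1)
      show "connected (closure W)" by (intro connected_imp_connected_closure \<open>connected W\<close>)
      fix z assume "z \<in> closure W"
      then obtain w where w: "w \<in> W" "dist w z < \<epsilon>/2"
        unfolding closure_approachable using half_gt_zero[OF \<open>\<epsilon> > 0\<close>] by blast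
      obtain a where "a \<in> A" "dist a w < \<epsilon>/2" using near w by blast
      then show "\<exists>a\<in>A. dist a z < \<epsilon>"
        using w dist_triangle[of a z w] by (intro bexI[of _ a]) auto
    next
      fix z assume "z \<in> X" "\<exists>a\<in>A. dist a z < \<delta>"
      then obtain a where a: "a \<in> A" "dist a z < \<delta>" by blast
      have "a \<in> X" using a(1) A(1) by blast
      obtain C where C: "connected C" "C \<subseteq> X" "a \<in> C" "z \<in> C" "C \<subseteq> ball a (\<epsilon>/2)"
        using \<delta>(2)[rule_format, OF \<open>a \<in> X\<close> \<open>z \<in> X\<close> a(2)] by blast
      then have "C \<in> F" using a(1) unfolding F_def by blast
      then have "z \<in> W" using C(4) unfolding W_def by blast
      then show "z \<in> closure W" using closure_subset by blast
    qed (use clX in auto)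
  qed
  then show ?thesis by (rule that[OF \<delta>(1)])
qed

section \<open>The Hausdorff distance and the induced map\<close>

lemma hausdorff_dist_commute: "hausdorff_dist A B = hausdorff_dist B A"
  by (simp add: hausdorff_dist_def max.commute)

lemma hausdorff_dist_less_imp_near:
  fixes A B :: "'a::metric_space set"
  assumes "bounded A" "B \<noteq> {}" "hausdorff_dist A B < r" "a \<in> A"
  shows "\<exists>b\<in>B. dist a b < r"
proof -
  obtain b where "b \<in> B" using assms(2) by blast
  obtain e where "\<And>a. a \<in> A \<Longrightarrow> dist b a \<le> e"
    using assms(1) bounded_any_center by blast
  then have "infdist a B \<le> e" if "a \<in> A" for a
    using infdist_le2[OF \<open>b \<in> B\<close>, of a e] that by (simp add: dist_commute)
  then have "bdd_above ((\<lambda>a. infdist a B) ` A)"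
    by (rule bdd_aboveI2)
  then have "infdist a B \<le> (SUP a\<in>A. infdist a B)"
    using assms(4) by (rule cSUP_upper[rotated])
  then have "infdist a B < r"
    using assms(3) unfolding hausdorff_dist_def by linarith
  then show ?thesis
    unfolding infdist_notempty[OF assms(2)]
    by (subst (asm) cINF_less_iff) (use assms(2) in \<open>auto intro: bdd_belowI2[of _ 0]\<close>)
qed

lemma hausdorff_dist_le:
  assumes "A \<noteq> {}" "B \<noteq> {}"
    and "\<And>a. a \<in> A \<Longrightarrow> \<exists>b\<in>B. dist a b \<le> r" "\<And>b. b \<in> B \<Longrightarrow> \<exists>a\<in>A. dist b a \<le> r"
  shows "hausdorff_dist A B \<le> r"
  unfolding hausdorff_dist_def
  by (intro max.boundedI cSUP_least assms) (use assms(3,4) infdist_le2 in blast)+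

lemma hausdorff_dist_singletons: "hausdorff_dist {u} {v} = dist u v"
  by (simp add: hausdorff_dist_def dist_commute)

lemma induced_map_funpow:
  fixes f :: "'a \<Rightarrow> 'a"
  shows "(induced_map f ^^ n) A = (f ^^ n) ` A"
  by (induction n) (auto simp: induced_map_def image_image)

section \<open>Shadowing\<close>

text \<open>Backward steps down to \<open>0\<close> and forward steps for ever. Applied to a pseudo-orbit \<open>A\<close> of sets, it
  yields a pseudo-orbit of points that stays in \<open>A\<close> and visits a prescribed point.\<close>

lemma thread_through_point:
  fixes A :: "nat \<Rightarrow> 'a set"
  assumes "\<And>i u. u \<in> A i \<Longrightarrow> \<exists>v\<in>A (Suc i). R u v"
    and "\<And>i v. v \<in> A (Suc i) \<Longrightarrow> \<exists>u\<in>A i. R u v"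
    and "a \<in> A n"
  shows "\<exists>x. x n = a \<and> (\<forall>i. x i \<in> A i \<and> R (x i) (x (Suc i)))"
  using assms
proof (induction n arbitrary: A)
  case 0
  have "\<exists>x. \<forall>i. (x i \<in> A i \<and> (i = 0 \<longrightarrow> x i = a)) \<and> R (x i) (x (Suc i))"
  proof (rule dependent_nat_choice)
    show "\<exists>x. x \<in> A 0 \<and> (0 = (0::nat) \<longrightarrow> x = a)" using 0 by blast
  qed (use 0 in blast)
  then show ?case by metis
next
  case (Suc n)
  have "\<exists>x. x n = a \<and> (\<forall>i. x i \<in> A (Suc i) \<and> R (x i) (x (Suc i)))"
    using Suc.prems by (intro Suc.IH) auto
  then obtain x where x: "x n = a" "\<And>i. x i \<in> A (Suc i)" "\<And>i. R (x i) (x (Suc i))" by blast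
  obtain u where u: "u \<in> A 0" "R u (x 0)" using Suc.prems(2)[OF x(2)] by blast
  have "case_nat u x i \<in> A i \<and> R (case_nat u x i) (case_nat u x (Suc i))" for i
    using x u by (cases i) auto
  then show ?case using x(1) by (intro exI[of _ "case_nat u x"]) auto
qed

text \<open>A pseudo-orbit of points is a pseudo-orbit of singletons; every point of a continuum that shadows
  the singletons shadows the points.\<close>

lemma shadowing_induced_map_imp_shadowing:
  fixes X :: "'a::metric_space set"
  assumes "bounded X" "f ` X \<subseteq> X"
    and "shadowing_property (subcontinua X) hausdorff_dist (induced_map f)"
  shows "shadowing_property X dist f"
  unfolding shadowing_property_def
proof (intro allI impI)
  fix \<epsilon> :: real assume "\<epsilon> > 0"
  then obtain \<delta> where \<delta>: "\<delta> > 0" "\<And>S. (\<forall>n. S n \<in> subcontinua X) \<and>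
      (\<forall>n. hausdorff_dist (induced_map f (S n)) (S (Suc n)) < \<delta>) \<Longrightarrow>
      \<exists>Y\<in>subcontinua X. \<forall>n. hausdorff_dist ((induced_map f ^^ n) Y) (S n) < \<epsilon>"
    using assms(3) unfolding shadowing_property_def by blast
  have "\<exists>y\<in>X. \<forall>n. dist ((f ^^ n) y) (x n) < \<epsilon>"
    if x: "\<forall>n. x n \<in> X" "\<forall>n. dist (f (x n)) (x (Suc n)) < \<delta>" for x
  proof -
    have "\<exists>Y\<in>subcontinua X. \<forall>n. hausdorff_dist ((induced_map f ^^ n) Y) {x n} < \<epsilon>"
      by (rule \<delta>(2)) (use x in
        \<open>auto simp: subcontinua_def continuum_def induced_map_def hausdorff_dist_singletons\<close>)
    then obtain Y where Y: "Y \<in> subcontinua X" "\<And>n. hausdorff_dist ((f ^^ n) ` Y) {x n} < \<epsilon>"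
      unfolding induced_map_funpow by blast
    then obtain y where y: "y \<in> Y" "Y \<subseteq> X" by (auto simp: subcontinua_def continuum_def)
    have "dist ((f ^^ n) y) (x n) < \<epsilon>" for n
    proof -
      have "(f ^^ n) ` X \<subseteq> X"
        by (induction n) (use assms(2) in auto)
      then have "bounded ((f ^^ n) ` Y)"
        using assms(1) y(2) by (meson bounded_subset image_mono)
      then show ?thesis
        using hausdorff_dist_less_imp_near[OF _ _ Y(2)[of n]] y(1) by blast
    qed
    then show ?thesis using y by blast
  qed
  then show "\<exists>\<delta>>0. \<forall>x. (\<forall>n. x n \<in> X) \<and> (\<forall>n. dist (f (x n)) (x (Suc n)) < \<delta>) \<longrightarrow>
      (\<exists>y\<in>X. \<forall>n. dist ((f ^^ n) y) (x n) < \<epsilon>)"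
    using \<delta>(1) by blast
qed

text \<open>Given a pseudo-orbit \<open>A\<close> of subcontinua, enlarge each \<open>A n\<close> to a subcontinuum \<open>K n\<close>. The set \<open>Y\<close> of
  all points whose \<open>n\<close>-th iterate lies in \<open>K n\<close> for all \<open>n\<close> is an intersection of preimages of
  continua, connected by hereditary unicoherence, and its images stay near the sets \<open>A n\<close>. That the images come close to every point of
  \<open>A n\<close> follows by shadowing a pseudo-orbit of points through that point, since the shadowing
  point belongs to \<open>Y\<close>.\<close>

lemma shadowing_imp_shadowing_induced_map:
  fixes X :: "'a::metric_space set"
  assumes X: "compact X" "connected X" "uniformly_locally_connected X" "hereditarily_unicoherent X"
    and f: "continuous_on X f" "f ` X \<subseteq> X" "\<And>y. y \<in> X \<Longrightarrow> connected {x \<in> X. f x = y}"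
    and shadow: "shadowing_property X dist f"
  shows "shadowing_property (subcontinua X) hausdorff_dist (induced_map f)"
  unfolding shadowing_property_def
proof (intro allI impI)
  fix \<epsilon> :: real assume "\<epsilon> > 0"
  define E where "E \<gamma> A K \<longleftrightarrow> K \<subseteq> X \<and> compact K \<and> connected K \<and>
      (\<forall>z\<in>K. \<exists>a\<in>A. dist a z < \<epsilon>/2) \<and> (\<forall>z\<in>X. (\<exists>a\<in>A. dist a z < \<gamma>) \<longrightarrow> z \<in> K)" for \<gamma> A K
  obtain \<gamma> where \<gamma>: "\<gamma> > 0"
    "\<And>A. A \<subseteq> X \<Longrightarrow> A \<noteq> {} \<Longrightarrow> connected A \<Longrightarrow> \<exists>K. E \<gamma> A K"
    using subcontinuum_enlargement[OF X(1,3) half_gt_zero[OF \<open>\<epsilon> > 0\<close>], folded E_def] by blast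
  \<comment> \<open>Precision \<open>\<gamma>\<close> puts the shadowing orbits into the enlargements, precision \<open>\<epsilon>/2\<close> keeps them
    close to the prescribed points.\<close>
  have "min \<gamma> (\<epsilon>/2) > 0" using \<gamma>(1) \<open>\<epsilon> > 0\<close> by simp
  then obtain \<delta> where \<delta>: "\<delta> > 0" "\<And>x. (\<forall>n. x n \<in> X) \<and> (\<forall>n. dist (f (x n)) (x (Suc n)) < \<delta>) \<Longrightarrow>
      \<exists>y\<in>X. \<forall>n. dist ((f ^^ n) y) (x n) < min \<gamma> (\<epsilon>/2)"
    using shadow unfolding shadowing_property_def by blast
  have "\<exists>Y\<in>subcontinua X. \<forall>n. hausdorff_dist ((induced_map f ^^ n) Y) (A n) < \<epsilon>"
    if A: "\<forall>n. A n \<in> subcontinua X"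
      and step: "\<forall>n. hausdorff_dist (induced_map f (A n)) (A (Suc n)) < \<delta>" for A
  proof -
    have A': "A n \<subseteq> X" "A n \<noteq> {}" "compact (A n)" "connected (A n)" for n
      using A by (auto simp: subcontinua_def continuum_def)
    have "\<exists>K. \<forall>n. E \<gamma> (A n) (K n)"
      by (rule choice) (use \<gamma>(2)[OF A'(1,2,4)] in blast)
    then obtain K where E: "\<And>n. E \<gamma> (A n) (K n)" by blast
    have K: "K n \<subseteq> X" "compact (K n)" "connected (K n)"
      and K_near: "z \<in> K n \<Longrightarrow> \<exists>a\<in>A n. dist a z < \<epsilon>/2"
      and near_K: "z \<in> X \<Longrightarrow> a \<in> A n \<Longrightarrow> dist a z < \<gamma> \<Longrightarrow> z \<in> K n" for n z a
      using E[of n] by (simp_all add: E_def) blast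
    define L where "L n = {x \<in> X. (f ^^ n) x \<in> K n}" for n
    define Y where "Y = (\<Inter>n. L n)"
    have L: "L n \<subseteq> X" "compact (L n)" "connected (L n)" for n
    proof -
      show "L n \<subseteq> X" by (auto simp: L_def)
      have "compact (L n) \<and> connected (L n)"
        unfolding L_def by (rule subcontinuum_monotone_preimage_funpow[OF X(1,2,4) f K])
      then show "compact (L n)" "connected (L n)" by simp_all
    qed
    have iter: "(f ^^ n) y \<in> X" if "y \<in> X" for n y
    proof (induction n)
      case (Suc n)
      then show ?case using f(2) by (simp add: image_subset_iff)
    qed (use that in simp)
    have near: "\<exists>y\<in>Y. dist ((f ^^ n) y) a < \<epsilon>/2" if a: "a \<in> A n" for n a
    proof -
      have "\<exists>x. x n = a \<and> (\<forall>i. x i \<in> A i \<and> dist (f (x i)) (x (Suc i)) < \<delta>)"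
      proof (rule thread_through_point[where A = A and R = "\<lambda>u v. dist (f u) v < \<delta>", OF _ _ a])
        fix i
        have comp: "compact (f ` A i)"
          by (intro compact_continuous_image continuous_on_subset[OF f(1)] A')
        have hd: "hausdorff_dist (f ` A i) (A (Suc i)) < \<delta>"
          using step by (simp add: induced_map_def)
        then have hd': "hausdorff_dist (A (Suc i)) (f ` A i) < \<delta>"
          by (subst hausdorff_dist_commute)
        show "\<exists>v\<in>A (Suc i). dist (f u) v < \<delta>" if "u \<in> A i" for u
          by (rule hausdorff_dist_less_imp_near[OF compact_imp_bounded[OF comp] A'(2) hd])
            (use that in blast)
        show "\<exists>u\<in>A i. dist (f u) v < \<delta>" if "v \<in> A (Suc i)" for v
        proof -
          have "f ` A i \<noteq> {}" using A'(2) by simp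
          then have "\<exists>w\<in>f ` A i. dist v w < \<delta>"
            using that by (rule hausdorff_dist_less_imp_near[OF compact_imp_bounded[OF A'(3)] _ hd'])
          then show ?thesis by (auto simp: dist_commute)
        qed
      qed
      then obtain x where x: "x n = a" "\<And>i. x i \<in> A i" "\<And>i. dist (f (x i)) (x (Suc i)) < \<delta>"
        by blast
      have "\<exists>y\<in>X. \<forall>i. dist ((f ^^ i) y) (x i) < min \<gamma> (\<epsilon>/2)"
        using x(2,3) A'(1) by (intro \<delta>(2)) auto
      then obtain y where y: "y \<in> X" "\<And>i. dist ((f ^^ i) y) (x i) < min \<gamma> (\<epsilon>/2)" by blast
      have "(f ^^ i) y \<in> K i" for i
        using near_K[OF iter[OF y(1)] x(2)[of i]] y(2)[of i] by (simp add: dist_commute)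
      then have "y \<in> Y" using y(1) by (auto simp: Y_def L_def)
      then show ?thesis using y(2)[of n] x(1) by auto
    qed
    have "Y \<noteq> {}" using near A'(2)[of 0] by blast
    moreover have "compact Y"
    proof -
      have "closed Y" unfolding Y_def using L(2) by (intro closed_INT) (auto intro: compact_imp_closed)
      then have "compact (L 0 \<inter> Y)" using L(2) by (rule compact_Int_closed[rotated])
      moreover have "L 0 \<inter> Y = Y" by (auto simp: Y_def)
      ultimately show ?thesis by simp
    qed
    moreover have "connected Y"
      unfolding Y_def using connected_INT_hereditarily_unicoherent[OF X(4) L] .
    moreover have "Y \<subseteq> X" using L(1) by (auto simp: Y_def)
    ultimately have "Y \<in> subcontinua X" by (simp add: subcontinua_def continuum_def)
    moreover have "hausdorff_dist ((induced_map f ^^ n) Y) (A n) < \<epsilon>" for n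
    proof -
      have "hausdorff_dist ((f ^^ n) ` Y) (A n) \<le> \<epsilon>/2"
      proof (rule hausdorff_dist_le)
        fix z assume "z \<in> (f ^^ n) ` Y"
        then have "z \<in> K n" by (auto simp: Y_def L_def)
        then show "\<exists>a\<in>A n. dist z a \<le> \<epsilon>/2"
          using K_near[of z n] by (auto simp: dist_commute intro: less_imp_le)
      next
        fix a assume "a \<in> A n"
        then show "\<exists>z\<in>(f ^^ n) ` Y. dist a z \<le> \<epsilon>/2"
          using near[of a n] by (auto simp: dist_commute intro: less_imp_le)
      qed (use \<open>Y \<noteq> {}\<close> A' in auto)
      then show ?thesis using \<open>\<epsilon> > 0\<close> by (simp add: induced_map_funpow)
    qed
    ultimately show ?thesis by blast
  qed
  then show "\<exists>\<delta>>0. \<forall>A. (\<forall>n. A n \<in> subcontinua X) \<and>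
      (\<forall>n. hausdorff_dist (induced_map f (A n)) (A (Suc n)) < \<delta>) \<longrightarrow>
      (\<exists>Y\<in>subcontinua X. \<forall>n. hausdorff_dist ((induced_map f ^^ n) Y) (A n) < \<epsilon>)"
    using \<delta>(1) by blast
qed

theorem theorem3p6:
  fixes D :: "'a::metric_space set" and f :: "'a \<Rightarrow> 'a"
  assumes "dendrite D"
    and "continuous_on D f"
    and "monotone_map (top_of_set D) (top_of_set D) f"
  shows "shadowing_property D dist f \<longleftrightarrow>
    shadowing_property (subcontinua D) hausdorff_dist (induced_map f)"
proof -
  have D: "compact D" "connected D" "locally connected D"
    using assms(1) by (auto simp: dendrite_def peano_continuum_def continuum_def)
  have f: "f ` D \<subseteq> D" "\<And>y. y \<in> D \<Longrightarrow> connected {x \<in> D. f x = y}"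
    using assms(3) by (auto simp: monotone_map_def connectedin_subtopology)
  show ?thesis
  proof
    assume "shadowing_property D dist f"
    then show "shadowing_property (subcontinua D) hausdorff_dist (induced_map f)"
      using shadowing_imp_shadowing_induced_map[OF D(1,2) _ _ assms(2) f]
        compact_locally_connected_imp_uniformly[OF D(1,3)]
        dendrite_imp_hereditarily_unicoherent[OF assms(1)] by blast
  next
    assume "shadowing_property (subcontinua D) hausdorff_dist (induced_map f)"
    then show "shadowing_property D dist f"
      using shadowing_induced_map_imp_shadowing[OF compact_imp_bounded[OF D(1)] f(1)] by blast
  qed
qed

end
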